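(* For every integer $k\ge1$, there exist a real constant $C$ and an integer $n_0$ such that for every $n\ge n_0$ and every random variable $f:\Omega_n\to\mathbb R$, $$R_k(f)\leq C\cdot\sum_{M\subseteq W,\ |M|=k,\ \|\partial_Mf\|_1\neq0}\frac{\|\partial_Mf\|_2^2}{1+\left(\log\frac{\|\partial_Mf\|_2}{\|\partial_Mf\|_1}\right)^k}.$$
   Context: Fix $d\ge2$, real numbers $0<a<b$ and $p\in(0,1)$ (the constants may depend on these). For $n\in\mathbb N$, $W=W_n$ is the finite edge set of the graph with vertex set $\mathbb Z^d\cap[-2n,2n]^d$ in which $x,y$ are adjacent iff $\sum_i|x_i-y_i|=1$. $\Omega_n=\{a,b\}^{W_n}$ carries the product measure $\mathbb P$ with $\mathbb P(\omega_e=a)=p$, $\mathbb P(\omega_e=b)=1-p$ independently over $e\in W_n$. For $j\in W$, $\delta\in\{a,b\}$, $\sigma_j^\delta:\Omega_n\to\Omega_n$ replaces $\omega_j$ by $\delta$. For $\varphi:\Omega_n\to\mathbb R$, $\partial_j\varphi=\varphi\circ\sigma_j^b-\varphi\circ\sigma_j^a$, and $\partial_S\varphi=\partial_{s_1}\cdots\partial_{s_m}\varphi$ for nonempty $S=\{s_1,\dots,s_m\}\subseteq W$ (distinct $s_i$; order irrelevant). $\|g\|_q=(\mathbb E[|g|^q])^{1/q}$. $\Sigma_j(f)=\sum_{M\subseteq W,\,|M|=j}(\mathbb E[\partial_Mf])^2$, and the remainder is $R_k(f)=\sum_{j=k}^{\infty}(p(1-p))^j\Sigma_j(f)$ (a finite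 sum, since $\Sigma_j(f)=0$ for $j>|W|$). *)

theory Defs
  imports "HOL-Probability.Probability"
begin

type_synonym 'd edge = "(int ^ 'd) set"
type_synonym 'd config = "'d edge \<Rightarrow> real"

definition lattice_box :: "nat \<Rightarrow> (int ^ 'd::finite) set" where
  "lattice_box n = {x. \<forall>i. \<bar>x $ i\<bar> \<le> 2 * int n}"

definition edges :: "nat \<Rightarrow> 'd::finite edge set" where
  "edges n = {{x, y} | x y. x \<in> lattice_box n \<and> y \<in> lattice_box n \<and> (\<Sum>i\<in>UNIV. \<bar>x $ i - y $ i\<bar>) = 1}"

definition configs :: "real \<Rightarrow> real \<Rightarrow> nat \<Rightarrow> 'd::finite config set" where
  "configs a b n = (\<Pi>\<^sub>E e\<in>edges n. {a, b})"

definition edge_pmf :: "real \<Rightarrow> real \<Rightarrow> real \<Rightarrow> real pmf" where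
  "edge_pmf a b p = map_pmf (\<lambda>X. if X then a else b) (bernoulli_pmf p)"

text \<open>The default value \<^term>\<open>undefined\<close> off \<^term>\<open>edges n\<close> makes the product law live on the
  extensional functions \<^term>\<open>configs a b n\<close>; see \<open>set_config_pmf\<close> below.\<close>

definition config_pmf :: "real \<Rightarrow> real \<Rightarrow> real \<Rightarrow> nat \<Rightarrow> 'd::finite config pmf" where
  "config_pmf a b p n = Pi_pmf (edges n) undefined (\<lambda>_. edge_pmf a b p)"

text \<open>A random variable is represented by a total function on configurations. Its values off
  \<^term>\<open>configs a b n\<close> are irrelevant: that set carries the law and is preserved by \<open>resample\<close>.\<close>

definition resample :: "'e \<Rightarrow> real \<Rightarrow> ('e \<Rightarrow> real) \<Rightarrow> 'e \<Rightarrow> real" where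
  "resample j \<delta> \<omega> = fun_upd \<omega> j \<delta>"

definition deriv1 ::
  "real \<Rightarrow> real \<Rightarrow> 'e \<Rightarrow> (('e \<Rightarrow> real) \<Rightarrow> real) \<Rightarrow> ('e \<Rightarrow> real) \<Rightarrow> real" where
  "deriv1 a b j \<phi> = (\<lambda>\<omega>. \<phi> (resample j b \<omega>) - \<phi> (resample j a \<omega>))"

text \<open>The fold is independent of the order of composition by \<open>deriv1_commute\<close> below.\<close>

definition derivS ::
  "real \<Rightarrow> real \<Rightarrow> 'e set \<Rightarrow> (('e \<Rightarrow> real) \<Rightarrow> real) \<Rightarrow> ('e \<Rightarrow> real) \<Rightarrow> real" where
  "derivS a b S \<phi> = Finite_Set.fold (deriv1 a b) \<phi> S"

definition Lnorm :: "'c pmf \<Rightarrow> real \<Rightarrow> ('c \<Rightarrow> real) \<Rightarrow> real" where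
  "Lnorm P q g = (measure_pmf.expectation P (\<lambda>\<omega>. \<bar>g \<omega>\<bar> powr q)) powr (1 / q)"

definition level_sum ::
  "real \<Rightarrow> real \<Rightarrow> real \<Rightarrow> nat \<Rightarrow> nat \<Rightarrow> ('d::finite config \<Rightarrow> real) \<Rightarrow> real" where
  "level_sum a b p n j f =
     (\<Sum>M | M \<subseteq> edges n \<and> card M = j. (measure_pmf.expectation (config_pmf a b p n) (derivS a b M f))\<^sup>2)"

definition remainder ::
  "real \<Rightarrow> real \<Rightarrow> real \<Rightarrow> nat \<Rightarrow> nat \<Rightarrow> ('d::finite config \<Rightarrow> real) \<Rightarrow> real" where
  "remainder a b p n k f = (\<Sum>\<^sub>\<infinity>j\<in>{k..}. (p * (1 - p)) ^ j * level_sum a b p n j f)"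

lemma finite_lattice_box: "finite (lattice_box n :: (int ^ 'd::finite) set)"
proof -
  let ?F = "PiE (UNIV :: 'd set) (\<lambda>_. {- 2 * int n..2 * int n})"
  have "lattice_box n \<subseteq> vec_lambda ` ?F"
  proof
    fix x :: "int ^ 'd" assume x: "x \<in> lattice_box n"
    have "x $ i \<in> {- 2 * int n..2 * int n}" for i
    proof -
      have "\<bar>x $ i\<bar> \<le> 2 * int n" using x by (simp add: lattice_box_def)
      then show ?thesis by simp arith
    qed
    then have "vec_nth x \<in> ?F" by auto
    then show "x \<in> vec_lambda ` ?F" by (metis image_eqI vec_nth_inverse)
  qed
  moreover have "finite ?F" by (rule finite_PiE) auto
  ultimately show ?thesis by (meson finite_imageI finite_subset)
qed

lemma finite_edges: "finite (edges n)"
proof (rule finite_subset)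
  show "edges n \<subseteq> Pow (lattice_box n)" by (auto simp: edges_def)
qed (simp add: finite_lattice_box)

lemma set_config_pmf:
  assumes "0 < p" "p < 1"
  shows "set_pmf (config_pmf a b p n) = configs a b n"
proof -
  have "set_pmf (edge_pmf a b p) = {a, b}"
    using assms by (auto simp: edge_pmf_def set_pmf_bernoulli UNIV_bool)
  then show ?thesis
    by (simp add: config_pmf_def configs_def set_Pi_pmf[OF finite_edges] PiE_dflt_def)
       (auto simp: PiE_iff extensional_def)
qed

lemma resample_in_configs:
  assumes "\<omega> \<in> configs a b n" "j \<in> edges n" "\<delta> \<in> {a, b}"
  shows "resample j \<delta> \<omega> \<in> configs a b n"
  using assms by (auto simp: configs_def resample_def PiE_iff extensional_def)

lemma deriv1_commute: "deriv1 a b i (deriv1 a b j \<phi>) = deriv1 a b j (deriv1 a b i \<phi>)"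
  by (cases "i = j") (auto simp: deriv1_def resample_def fun_upd_twist)

interpretation deriv1: comp_fun_commute "deriv1 a b"
  by unfold_locales (rule ext, simp add: deriv1_commute)

lemma derivS_empty: "derivS a b {} \<phi> = \<phi>"
  by (simp add: derivS_def)

lemma derivS_insert:
  "finite S \<Longrightarrow> j \<notin> S \<Longrightarrow> derivS a b (insert j S) \<phi> = deriv1 a b j (derivS a b S \<phi>)"
  by (simp add: derivS_def)

lemma level_sum_eq_0:
  fixes f :: "'d::finite config \<Rightarrow> real"
  assumes "card (edges n :: 'd edge set) < j"
  shows "level_sum a b p n j f = 0"
proof -
  have "{M. M \<subseteq> (edges n :: 'd edge set) \<and> card M = j} = {}"
    using card_mono[OF finite_edges] assms by (metis (mono_tags, lifting) empty_Collect_eq leD)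
  then show ?thesis by (simp only: level_sum_def sum.empty)
qed

lemma remainder_eq_sum:
  fixes f :: "'d::finite config \<Rightarrow> real"
  shows "remainder a b p n k f
    = (\<Sum>j = k..card (edges n :: 'd edge set). (p * (1 - p)) ^ j * level_sum a b p n j f)"
proof -
  have "remainder a b p n k f
    = (\<Sum>\<^sub>\<infinity>j\<in>{k..card (edges n :: 'd edge set)}. (p * (1 - p)) ^ j * level_sum a b p n j f)"
    unfolding remainder_def by (rule infsum_cong_neutral) (auto simp: level_sum_eq_0)
  then show ?thesis by simp
qed

end

theory Submission
  imports Defs
begin

text \<open>The remainder is the Fourier weight of \<open>f\<close> on the levels \<open>\<ge> k\<close>, and the theorem is the
  order-\<open>k\<close> form of Talagrand's inequality \<open>Var f \<le> C \<Sum>\<^sub>j \<parallel>\<partial>\<^sub>j f\<parallel>\<^sub>2\<^sup>2 / (1 + log (\<parallel>\<partial>\<^sub>j f\<parallel>\<^sub>2 / \<parallel>\<partial>\<^sub>j f\<parallel>\<^sub>1))\<close>.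
  The proof is Fourier analysis on the biased cube \<open>{a, b}\<^sup>I\<close> over a finite index set \<open>I\<close>, with constants
  uniform in \<open>I\<close>; the theorem is the case where \<open>I\<close> consists of the edges of the box.

  Let \<open>\<chi>\<^sub>T\<close> be the product over \<open>j \<in> T\<close> of the centred coordinate that jumps by one between \<open>a\<close> and
  \<open>b\<close>. These characters are orthogonal with \<open>\<parallel>\<chi>\<^sub>T\<parallel>\<^sub>2\<^sup>2 = (p (1 - p))\<^bsup>|T|\<^esup>\<close>, and integration by parts
  (\<open>mean_character_mult\<close>) shows that the coefficient of \<open>g\<close> along \<open>\<chi>\<^sub>T\<close> is \<open>E \<partial>\<^sub>T g\<close>. So
  \<open>(p (1 - p))\<^bsup>|T|\<^esup> (E \<partial>\<^sub>T g)\<^sup>2\<close> is the energy of \<open>g\<close> at \<open>T\<close>, and Bessel's inequality bounds the total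
  energy by \<open>\<parallel>g\<parallel>\<^sub>2\<^sup>2\<close>.

  A set of size \<open>s \<ge> k\<close> has \<open>s choose k\<close> subsets \<open>M\<close> of size \<open>k\<close>. Sharing the energy of \<open>f\<close> at each such
  set equally among these \<open>M\<close> (\<open>sum_over_large_subsets\<close>) turns the remainder into a sum over \<open>M\<close>
  of the energies of \<open>g = \<partial>\<^sub>M f\<close> at the sets \<open>T\<close> disjoint from \<open>M\<close>, where the energy at \<open>T\<close> is divided by
  \<open>k + |T| choose k\<close>, up to the constant factor \<open>(p (1 - p))\<^sup>k\<close>. This divisor grows like \<open>(1 + |T|)\<^sup>k\<close>, and it is what becomes the \<open>k\<close>-th power
  of the logarithm.

  Indeed, a function whose \<open>L\<^sup>1\<close> norm is much smaller than its \<open>L\<^sup>2\<close> norm has little energy at low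
  degrees. By Bonami's lemma (\<open>fourth_moment_low_degree\<close>) the fourth moment of a function of degree
  at most \<open>L\<close> is at most \<open>\<beta>\<^bsup>2L\<^esup>\<close> times the square of its second moment; pairing \<open>g\<close> with its
  truncation to degree \<open>L\<close> then bounds the energy of \<open>g\<close> up to degree \<open>L\<close> by \<open>\<beta>\<^sup>L \<parallel>g\<parallel>\<^sub>2 \<parallel>g\<parallel>\<^sub>1\<close>
  (\<open>low_degree_energy_le\<close>). With \<open>X = log (\<parallel>g\<parallel>\<^sub>2 / \<parallel>g\<parallel>\<^sub>1)\<close> and \<open>L\<close> a small multiple of \<open>X\<close> this is
  \<open>\<parallel>g\<parallel>\<^sub>2\<^sup>2 exp (- X / 2)\<close>, whereas the divisor makes the higher degrees contribute
  \<open>O (\<parallel>g\<parallel>\<^sub>2\<^sup>2 / (1 + X)\<^sup>k)\<close>. Both are \<open>O (\<parallel>g\<parallel>\<^sub>2\<^sup>2 / (1 + X\<^sup>k))\<close> (\<open>damped_energy_le\<close>).\<close>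

section \<open>Finite expectations\<close>

text \<open>The quadratic form \<open>(s, t) \<mapsto> E (s u + t v)\<^sup>2\<close> is nonnegative. Its discriminant is read off at
  \<open>(B, - D)\<close> or \<open>(- D, A)\<close>, whichever of the diagonal entries \<open>B\<close>, \<open>A\<close> does not vanish.\<close>

lemma Cauchy_Schwarz_finite_pmf:
  fixes u v :: "'c \<Rightarrow> real"
  assumes fin: "finite (set_pmf P)"
  shows "(measure_pmf.expectation P (\<lambda>x. u x * v x))\<^sup>2
    \<le> measure_pmf.expectation P (\<lambda>x. (u x)\<^sup>2) * measure_pmf.expectation P (\<lambda>x. (v x)\<^sup>2)"
proof -
  define A where "A = measure_pmf.expectation P (\<lambda>x. (u x)\<^sup>2)"
  define B where "B = measure_pmf.expectation P (\<lambda>x. (v x)\<^sup>2)"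
  define D where "D = measure_pmf.expectation P (\<lambda>x. u x * v x)"
  note int = integrable_measure_pmf_finite[OF fin]
  have quad: "0 \<le> s\<^sup>2 * A + 2 * s * t * D + t\<^sup>2 * B" for s t :: real
  proof -
    have "0 \<le> measure_pmf.expectation P (\<lambda>x. (s * u x + t * v x)\<^sup>2)"
      by (rule Bochner_Integration.integral_nonneg) simp
    also have "(\<lambda>x. (s * u x + t * v x)\<^sup>2)
        = (\<lambda>x. s\<^sup>2 * (u x)\<^sup>2 + (2 * s * t) * (u x * v x) + t\<^sup>2 * (v x)\<^sup>2)"
      by (rule ext) (simp add: power2_eq_square algebra_simps)
    also have "measure_pmf.expectation P \<dots> = s\<^sup>2 * A + 2 * s * t * D + t\<^sup>2 * B"
      unfolding A_def B_def D_def
      by (subst Bochner_Integration.integral_add, rule int, rule int)+ simp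
    finally show ?thesis .
  qed
  have nn: "0 \<le> A" "0 \<le> B" unfolding A_def B_def by simp_all
  have "D\<^sup>2 \<le> A * B"
  proof (cases "B = 0")
    case False
    have "0 \<le> B * (A * B - D\<^sup>2)"
      using quad[of B "- D"] by (simp add: power2_eq_square algebra_simps)
    with False nn(2) show ?thesis by (simp add: zero_le_mult_iff)
  next
    case True
    show ?thesis
    proof (cases "A = 0")
      case True
      with \<open>B = 0\<close> show ?thesis using quad[of 1 1] quad[of 1 "-1"] by simp
    next
      case False
      have "0 \<le> A * (A * B - D\<^sup>2)"
        using quad[of "- D" A] by (simp add: power2_eq_square algebra_simps)
      with False nn(1) show ?thesis by (simp add: zero_le_mult_iff)
    qed
  qed
  then show ?thesis by (simp add: A_def B_def D_def)
qed

section \<open>Discrete calculus on the biased cube\<close>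

lemma derivS_deriv1:
  assumes "finite S"
  shows "derivS a b S (deriv1 a b j \<phi>) = deriv1 a b j (derivS a b S \<phi>)"
  using assms unfolding derivS_def by (simp add: deriv1.fold_fun_left_comm)

lemma derivS_Un:
  assumes "finite S" "finite T" "S \<inter> T = {}"
  shows "derivS a b (S \<union> T) \<phi> = derivS a b S (derivS a b T \<phi>)"
  using assms by (induction S) (simp_all add: derivS_empty derivS_insert)

lemma derivS_sum:
  assumes "finite S"
  shows "derivS a b S (\<lambda>\<omega>. \<Sum>i\<in>F. c i * \<phi> i \<omega>) = (\<lambda>\<omega>. \<Sum>i\<in>F. c i * derivS a b S (\<phi> i) \<omega>)"
  using assms
  by (induction S)
     (simp_all add: derivS_empty derivS_insert deriv1_def sum_subtractf right_diff_distrib)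

locale biased_cube =
  fixes a b p :: real
  assumes a_less_b: "a < b" and p_pos: "0 < p" and p_less_1: "p < 1"
begin

definition cube_pmf :: "'e set \<Rightarrow> ('e \<Rightarrow> real) pmf" where
  "cube_pmf I = Pi_pmf I undefined (\<lambda>_. edge_pmf a b p)"

abbreviation mean :: "'e set \<Rightarrow> (('e \<Rightarrow> real) \<Rightarrow> real) \<Rightarrow> real" where
  "mean I \<phi> \<equiv> measure_pmf.expectation (cube_pmf I) \<phi>"

text \<open>The averaging operator of one coordinate. Together with the difference operator it splits a
  function on configurations with values in \<open>{a, b}\<close> as \<open>\<phi> = avg j \<phi> + coord j \<cdot> \<partial>\<^sub>j \<phi>\<close>, with \<open>coord\<close>
  as below; both parts are free of the coordinate \<open>j\<close>, which drives the inductions on the index set.\<close>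

definition avg :: "'e \<Rightarrow> (('e \<Rightarrow> real) \<Rightarrow> real) \<Rightarrow> ('e \<Rightarrow> real) \<Rightarrow> real" where
  "avg j \<phi> \<omega> = p * \<phi> (resample j a \<omega>) + (1 - p) * \<phi> (resample j b \<omega>)"

text \<open>The centred coordinate, normalised to jump by one: \<open>\<partial>\<^sub>j (coord j) = 1\<close>. Its variance is
  therefore \<open>p (1 - p)\<close> rather than one, and Fourier coefficients along products of coordinates are
  exactly the means of iterated differences.\<close>

definition coord :: "'e \<Rightarrow> ('e \<Rightarrow> real) \<Rightarrow> real" where
  "coord j \<omega> = (if \<omega> j = b then p else p - 1)"

definition character :: "'e set \<Rightarrow> ('e \<Rightarrow> real) \<Rightarrow> real" where
  "character T \<omega> = (\<Prod>j\<in>T. coord j \<omega>)"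

abbreviation pq :: real where
  "pq \<equiv> p * (1 - p)"

abbreviation "D \<equiv> deriv1 a b"
abbreviation "DS \<equiv> derivS a b"

lemma pq_pos: "0 < pq"
  using p_pos p_less_1 by simp

lemma pq_le: "pq \<le> 1 / 4"
proof -
  have "0 \<le> (p - 1 / 2)\<^sup>2" by simp
  then show ?thesis by (simp add: power2_eq_square algebra_simps)
qed

lemma finite_set_cube_pmf:
  assumes "finite I"
  shows "finite (set_pmf (cube_pmf I))"
proof -
  have "finite (set_pmf (edge_pmf a b p))" by (simp add: edge_pmf_def)
  then show ?thesis unfolding cube_pmf_def set_Pi_pmf[OF assms]
    by (intro finite_PiE_dflt assms) simp
qed

lemma integrable_cube [simp]: "finite I \<Longrightarrow> integrable (cube_pmf I) (\<phi> :: _ \<Rightarrow> real)"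
  by (rule integrable_measure_pmf_finite) (rule finite_set_cube_pmf)

lemma mean_mono: "finite I \<Longrightarrow> (\<And>\<omega>. \<phi> \<omega> \<le> \<psi> \<omega>) \<Longrightarrow> mean I \<phi> \<le> mean I \<psi>"
  by (rule integral_mono) simp_all

lemma mean_empty: "mean {} \<phi> = \<phi> (\<lambda>_. undefined)"
  by (simp add: cube_pmf_def)

text \<open>Fubini for a single coordinate.\<close>

lemma mean_insert:
  assumes "finite J" "j \<notin> J"
  shows "mean (insert j J) \<phi> = mean J (avg j \<phi>)"
proof -
  have "mean (insert j J) \<phi> = measure_pmf.expectation (bernoulli_pmf p)
      (\<lambda>X. mean J (\<lambda>\<omega>. \<phi> (fun_upd \<omega> j (if X then a else b))))"
  proof -
    have *: "cube_pmf (insert j J) = bernoulli_pmf p \<bind>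
       (\<lambda>X. map_pmf (\<lambda>\<omega>. fun_upd \<omega> j (if X then a else b)) (cube_pmf J))"
      unfolding cube_pmf_def edge_pmf_def
      by (subst Pi_pmf_insert'[OF assms])
         (simp add: map_pmf_def bind_assoc_pmf bind_return_pmf)
    show ?thesis unfolding *
      by (subst pmf_expectation_bind[of UNIV])
         (use p_pos p_less_1 assms in \<open>auto simp: finite_set_cube_pmf UNIV_bool\<close>)
  qed
  also have "\<dots> = mean J (avg j \<phi>)"
    using p_pos p_less_1 assms(1) by (simp add: avg_def[abs_def] resample_def)
  finally show ?thesis .
qed

lemma mean_avg:
  assumes "finite I" "j \<in> I"
  shows "mean I (avg j \<phi>) = mean I \<phi>"
proof -
  have "avg j (avg j \<phi>) = avg j \<phi>"
    by (rule ext) (simp add: avg_def resample_def algebra_simps)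
  moreover have "I = insert j (I - {j})" using assms(2) by blast
  ultimately show ?thesis using mean_insert[of "I - {j}" j] assms(1)
    by (metis DiffE finite_Diff singletonI)
qed

lemma deriv1_avg: "D i (avg j \<phi>) = (if i = j then (\<lambda>_. 0) else avg j (D i \<phi>))"
  by (rule ext) (simp add: deriv1_def avg_def resample_def fun_upd_twist algebra_simps)

lemma derivS_avg:
  assumes "finite S" "j \<notin> S"
  shows "DS S (avg j \<phi>) = avg j (DS S \<phi>)"
  using assms by (induction S) (auto simp: derivS_empty derivS_insert deriv1_avg)

lemma avg_square: "avg j (\<lambda>\<omega>. (h \<omega>)\<^sup>2) \<omega> = (avg j h \<omega>)\<^sup>2 + pq * (D j h \<omega>)\<^sup>2"
  by (simp add: avg_def deriv1_def power2_eq_square algebra_simps)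

text \<open>The binomial expansion of \<open>(u + coord j \<cdot> d)\<^sup>4\<close>, with \<open>u = avg j h\<close> and \<open>d = \<partial>\<^sub>j h\<close>, loses its term
  linear in \<open>d\<close> under averaging as the coordinate is centred. For \<open>p \<noteq> 1 / 2\<close> the cubic term survives; it has no sign and is
  absorbed into its two neighbours, so that only even powers remain.\<close>

lemma avg_fourth_le:
  "avg j (\<lambda>\<omega>. (h \<omega>) ^ 4) \<omega>
    \<le> (avg j h \<omega>) ^ 4 + 8 * pq * ((avg j h \<omega>)\<^sup>2 * (D j h \<omega>)\<^sup>2) + 3 * pq * (D j h \<omega>) ^ 4"
proof -
  define u where "u = avg j h \<omega>"
  define d where "d = D j h \<omega>"
  have x: "h (resample j a \<omega>) = u - (1 - p) * d" and y: "h (resample j b \<omega>) = u + p * d"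
    by (simp_all add: u_def d_def avg_def deriv1_def algebra_simps)
  have "avg j (\<lambda>\<omega>. (h \<omega>) ^ 4) \<omega> = u ^ 4 + 6 * pq * (u\<^sup>2 * d\<^sup>2)
      + 4 * pq * (2 * p - 1) * (u * d ^ 3) + pq * (1 - 3 * pq) * d ^ 4"
    unfolding avg_def x y by (simp add: power2_eq_square power3_eq_cube power4_eq_xxxx algebra_simps)
  moreover have "4 * pq * (2 * p - 1) * (u * d ^ 3) \<le> 2 * pq * (u\<^sup>2 * d\<^sup>2) + 2 * pq * d ^ 4"
  proof -
    have c: "\<bar>2 * p - 1\<bar> \<le> 1" using p_pos p_less_1 by simp
    have "2 * ((2 * p - 1) * (u * d ^ 3)) \<le> 2 * \<bar>u * d ^ 3\<bar>"
    proof -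
      have "(2 * p - 1) * (u * d ^ 3) \<le> \<bar>2 * p - 1\<bar> * \<bar>u * d ^ 3\<bar>"
        by (metis abs_ge_self abs_mult)
      also have "\<dots> \<le> 1 * \<bar>u * d ^ 3\<bar>" by (rule mult_right_mono[OF c]) simp
      finally show ?thesis by simp
    qed
    also have "\<dots> = 2 * \<bar>u * d\<bar> * d\<^sup>2"
      by (simp add: abs_mult power2_eq_square power3_eq_cube)
    also have "\<dots> \<le> (u * d)\<^sup>2 + (d\<^sup>2)\<^sup>2"
      using sum_squares_bound[of "\<bar>u * d\<bar>" "d\<^sup>2"] by (simp add: power2_eq_square)
    also have "\<dots> = u\<^sup>2 * d\<^sup>2 + d ^ 4" by (simp add: power_mult_distrib)
    finally have "2 * pq * (2 * ((2 * p - 1) * (u * d ^ 3))) \<le> 2 * pq * (u\<^sup>2 * d\<^sup>2 + d ^ 4)"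
      using pq_pos by (intro mult_left_mono) simp_all
    then show ?thesis by (simp add: algebra_simps)
  qed
  moreover have "pq * (1 - 3 * pq) * d ^ 4 \<le> pq * d ^ 4"
  proof (rule mult_right_mono)
    have "pq * (1 - 3 * pq) \<le> pq * 1" by (rule mult_left_mono) (use pq_pos in linarith)+
    then show "pq * (1 - 3 * pq) \<le> pq" by (simp only: mult_1_right)
  qed simp
  ultimately show ?thesis by (simp add: u_def d_def algebra_simps)
qed

section \<open>Hypercontractivity of low-degree functions\<close>

text \<open>The growth rate of the fourth moment per degree. The induction step of Bonami's lemma below
  closes once \<open>8 / \<beta> \<le> 2\<close> and \<open>3 / \<beta>\<^sup>2 \<le> pq\<close>, and both follow from \<open>pq \<le> 1 / 4\<close>.\<close>

definition \<beta> :: real where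
  "\<beta> = 4 / pq"

lemma beta_ge: "16 \<le> \<beta>"
  using pq_pos pq_le by (simp add: \<beta>_def field_simps)

text \<open>Bonami's lemma for the biased cube. Vanishing of all differences of order above \<open>L\<close> encodes
  that \<open>h\<close> has degree at most \<open>L\<close>. In the induction step \<open>h\<close> splits into \<open>u = avg j h\<close> of degree at
  most \<open>L\<close> and \<open>d = \<partial>\<^sub>j h\<close> of degree at most \<open>L - 1\<close>. The lower degree of \<open>d\<close> gains a factor \<open>\<beta>\<^sup>2\<close> in
  its fourth moment, and by Cauchy-Schwarz a factor \<open>\<beta>\<close> in the mixed term. These gains outweigh the
  binomial coefficients of the fourth power, so the bound is the square of
  \<open>E h\<^sup>2 = E u\<^sup>2 + p (1 - p) E d\<^sup>2\<close>.\<close>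

lemma fourth_moment_low_degree:
  assumes "finite I" "\<And>S. S \<subseteq> I \<Longrightarrow> L < card S \<Longrightarrow> DS S h = (\<lambda>_. 0)"
  shows "mean I (\<lambda>\<omega>. (h \<omega>) ^ 4) \<le> \<beta> ^ (2 * L) * (mean I (\<lambda>\<omega>. (h \<omega>)\<^sup>2))\<^sup>2"
  using assms
proof (induction I arbitrary: L h rule: finite_induct)
  case empty
  have "1 \<le> \<beta> ^ (2 * L)" using beta_ge by (intro one_le_power) simp
  then have "1 * h (\<lambda>_. undefined) ^ 4 \<le> \<beta> ^ (2 * L) * h (\<lambda>_. undefined) ^ 4"
    by (rule mult_right_mono) simp
  then show ?case by (simp add: mean_empty)
next
  case (insert j J)
  note fin = \<open>finite J\<close>
  define u where "u = avg j h"
  define d where "d = D j h"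
  define A where "A = mean J (\<lambda>\<omega>. (u \<omega>)\<^sup>2)"
  define V where "V = mean J (\<lambda>\<omega>. (d \<omega>)\<^sup>2)"
  define X where "X = mean J (\<lambda>\<omega>. (u \<omega>)\<^sup>2 * (d \<omega>)\<^sup>2)"
  define U4 where "U4 = mean J (\<lambda>\<omega>. (u \<omega>) ^ 4)"
  define D4 where "D4 = mean J (\<lambda>\<omega>. (d \<omega>) ^ 4)"
  define K where "K = \<beta> ^ (2 * L)"
  have nn: "0 \<le> A" "0 \<le> V" "0 \<le> X" "0 \<le> U4" "0 \<le> D4" "0 < K"
    using beta_ge by (simp_all add: A_def V_def X_def U4_def D4_def K_def)
  have U4: "U4 \<le> K * A\<^sup>2"
    unfolding U4_def A_def K_def
  proof (rule insert.IH)
    fix S assume S: "S \<subseteq> J" "L < card S"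
    then have "DS S u = avg j (DS S h)" unfolding u_def
      using insert.hyps by (intro derivS_avg) (auto intro: finite_subset)
    also have "DS S h = (\<lambda>_. 0)" using S by (intro insert.prems) auto
    finally show "DS S u = (\<lambda>_. 0)" by (simp add: avg_def[abs_def])
  qed
  \<comment> \<open>Multiplying by \<open>\<beta>\<^sup>2\<close> instead of lowering the exponent covers \<open>L = 0\<close>, where \<open>d\<close> vanishes.\<close>
  have D4: "\<beta>\<^sup>2 * D4 \<le> K * V\<^sup>2"
  proof (cases L)
    case 0
    have "DS {j} h = (\<lambda>_. 0)" using 0 by (intro insert.prems) auto
    then have "d = (\<lambda>_. 0)" by (simp add: d_def derivS_insert derivS_empty)
    then show ?thesis by (simp add: D4_def V_def)
  next
    case (Suc L')
    have "D4 \<le> \<beta> ^ (2 * L') * V\<^sup>2"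
      unfolding D4_def V_def
    proof (rule insert.IH)
      fix S assume S: "S \<subseteq> J" "L' < card S"
      have finS: "finite S" using S fin by (auto intro: finite_subset)
      have "DS (insert j S) h = (\<lambda>_. 0)"
        using S finS Suc insert.hyps by (intro insert.prems) (auto simp: card_insert_if)
      moreover have "j \<notin> S" using S insert.hyps by blast
      ultimately show "DS S d = (\<lambda>_. 0)"
        by (simp add: d_def derivS_deriv1[OF finS] derivS_insert[OF finS, symmetric])
    qed
    then have "\<beta>\<^sup>2 * D4 \<le> \<beta>\<^sup>2 * (\<beta> ^ (2 * L') * V\<^sup>2)" by (rule mult_left_mono) simp
    then show ?thesis by (simp add: K_def Suc power2_eq_square)
  qed
  have X: "\<beta> * X \<le> K * (A * V)"
  proof (rule power2_le_imp_le)
    have "X\<^sup>2 \<le> U4 * D4"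
      using Cauchy_Schwarz_finite_pmf[OF finite_set_cube_pmf[OF fin], of "\<lambda>\<omega>. (u \<omega>)\<^sup>2" "\<lambda>\<omega>. (d \<omega>)\<^sup>2"]
      by (simp add: X_def U4_def D4_def)
    then have "(\<beta> * X)\<^sup>2 \<le> U4 * (\<beta>\<^sup>2 * D4)"
      using mult_left_mono[of "X\<^sup>2" "U4 * D4" "\<beta>\<^sup>2"] by (simp add: power_mult_distrib mult_ac)
    also have "\<dots> \<le> (K * A\<^sup>2) * (K * V\<^sup>2)"
      by (rule mult_mono[OF U4 D4]) (use nn in simp_all)
    finally show "(\<beta> * X)\<^sup>2 \<le> (K * (A * V))\<^sup>2" by (simp add: power2_eq_square mult_ac)
    show "0 \<le> K * (A * V)" using nn by simp
  qed
  have vb: "pq * \<beta> = 4"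
  proof -
    have "pq \<noteq> 0" using pq_pos by linarith
    then have "pq * 4 / pq = 4" by (rule nonzero_mult_div_cancel_left)
    then show ?thesis by (simp only: \<beta>_def times_divide_eq_right)
  qed
  have "mean (insert j J) (\<lambda>\<omega>. (h \<omega>) ^ 4) = mean J (avg j (\<lambda>\<omega>. (h \<omega>) ^ 4))"
    by (rule mean_insert) (use insert.hyps in auto)
  also have "\<dots> \<le> mean J (\<lambda>\<omega>. (u \<omega>) ^ 4 + 8 * pq * ((u \<omega>)\<^sup>2 * (d \<omega>)\<^sup>2) + 3 * pq * (d \<omega>) ^ 4)"
    unfolding u_def d_def by (rule mean_mono[OF fin avg_fourth_le])
  also have "\<dots> = U4 + 8 * pq * X + 3 * pq * D4"
    using fin by (simp add: U4_def X_def D4_def)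
  also have "\<dots> \<le> K * A\<^sup>2 + 2 * pq * (K * (A * V)) + pq\<^sup>2 * (K * V\<^sup>2)"
  proof -
    have "2 * pq\<^sup>2 * (\<beta> * X) = 2 * pq * (pq * \<beta>) * X"
      by (simp only: power2_eq_square mult_ac)
    then have "8 * pq * X = 2 * pq\<^sup>2 * (\<beta> * X)" unfolding vb by linarith
    also have "\<dots> \<le> 2 * pq\<^sup>2 * (K * (A * V))" by (rule mult_left_mono[OF X]) simp
    also have "\<dots> \<le> 2 * pq * (K * (A * V))"
    proof (rule mult_right_mono)
      have "pq * pq \<le> pq * 1" using pq_pos pq_le by (intro mult_left_mono) simp_all
      then show "2 * pq\<^sup>2 \<le> 2 * pq" by (simp add: power2_eq_square)
      show "0 \<le> K * (A * V)" using nn by simp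
    qed
    finally have 1: "8 * pq * X \<le> 2 * pq * (K * (A * V))" .
    have "3 * pq * D4 \<le> 16 * D4"
      using pq_le by (intro mult_right_mono nn) linarith
    also have "\<dots> = pq\<^sup>2 * (\<beta>\<^sup>2 * D4)"
    proof -
      have "pq\<^sup>2 * (\<beta>\<^sup>2 * D4) = (pq * \<beta>)\<^sup>2 * D4" by (simp only: power_mult_distrib mult.assoc)
      then show ?thesis by (simp add: vb)
    qed
    also have "\<dots> \<le> pq\<^sup>2 * (K * V\<^sup>2)" by (rule mult_left_mono[OF D4]) simp
    finally show ?thesis using U4 1 by linarith
  qed
  also have "\<dots> = K * (A + pq * V)\<^sup>2" by (simp add: power2_eq_square algebra_simps)
  also have "A + pq * V = mean (insert j J) (\<lambda>\<omega>. (h \<omega>)\<^sup>2)"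
    using insert.hyps fin
    by (subst mean_insert) (simp_all add: avg_square[abs_def] A_def V_def u_def d_def)
  finally show ?case by (simp add: K_def)
qed

section \<open>Characters and Fourier coefficients\<close>

lemma coord_resample:
  "coord i (resample j b \<omega>) = (if i = j then p else coord i \<omega>)"
  "coord i (resample j a \<omega>) = (if i = j then p - 1 else coord i \<omega>)"
  using a_less_b by (auto simp: coord_def resample_def)

lemma character_resample:
  assumes "finite T" "j \<notin> T"
  shows "character T (resample j \<delta> \<omega>) = character T \<omega>"
  unfolding character_def
  by (rule prod.cong) (use assms in \<open>auto simp: coord_def resample_def\<close>)

lemma character_insert:
  "finite T \<Longrightarrow> j \<notin> T \<Longrightarrow> character (insert j T) \<omega> = coord j \<omega> * character T \<omega>"
  by (simp add: character_def)

lemma deriv1_character: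
  assumes "finite T"
  shows "D j (character T) = (if j \<in> T then character (T - {j}) else (\<lambda>_. 0))"
proof (cases "j \<in> T")
  case True
  then have "character T \<omega> = coord j \<omega> * character (T - {j}) \<omega>" for \<omega>
    using assms by (metis DiffE character_insert finite_Diff insertI1 insert_Diff)
  then show ?thesis using True assms
    by (auto simp: deriv1_def fun_eq_iff coord_resample character_resample algebra_simps)
qed (use assms in \<open>simp add: deriv1_def character_resample\<close>)

lemma derivS_character:
  assumes "finite S" "finite T"
  shows "DS S (character T) = (if S \<subseteq> T then character (T - S) else (\<lambda>_. 0))"
  using assms(1)
proof (induction S)
  case (insert j S)
  have diff: "T - S - {j} = T - insert j S" by blast
  have "DS (insert j S) (character T) = D j (if S \<subseteq> T then character (T - S) else (\<lambda>_. 0))"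
    using insert by (simp add: derivS_insert)
  also have "\<dots> = (if insert j S \<subseteq> T then character (T - insert j S) else (\<lambda>_. 0))"
    using insert.hyps assms(2) deriv1_character[of "T - S" j]
    by (simp add: diff) (simp add: deriv1_def)
  finally show ?case .
qed (simp add: derivS_empty)

text \<open>Integration by parts: for one coordinate, averaging \<open>coord j \<cdot> \<phi>\<close> over the values \<open>a\<close> and \<open>b\<close> gives
  \<open>p (p - 1) \<phi>(a) + (1 - p) p \<phi>(b) = p (1 - p) \<partial>\<^sub>j \<phi>\<close>. Iterated over \<open>T\<close> it identifies Fourier
  coefficients with mean differences.\<close>

lemma mean_character_mult:
  assumes "finite I" "T \<subseteq> I"
  shows "mean I (\<lambda>\<omega>. character T \<omega> * \<phi> \<omega>) = pq ^ card T * mean I (DS T \<phi>)"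
proof -
  have "finite T" using assms finite_subset by blast
  then show ?thesis using assms(2)
  proof (induction T arbitrary: \<phi>)
    case empty
    then show ?case by (simp add: character_def derivS_empty)
  next
    case (insert j T)
    have "mean I (\<lambda>\<omega>. character (insert j T) \<omega> * \<phi> \<omega>)
        = mean I (avg j (\<lambda>\<omega>. character (insert j T) \<omega> * \<phi> \<omega>))"
      using insert.prems assms(1) by (simp add: mean_avg)
    also have "avg j (\<lambda>\<omega>. character (insert j T) \<omega> * \<phi> \<omega>)
        = (\<lambda>\<omega>. pq * (character T \<omega> * D j \<phi> \<omega>))"
      using insert.hyps
      by (simp add: fun_eq_iff avg_def character_insert coord_resample character_resample
          deriv1_def algebra_simps)
    also have "mean I \<dots> = pq * (pq ^ card T * mean I (DS T (D j \<phi>)))"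
      using insert.IH[of "D j \<phi>"] insert.prems by simp
    finally show ?case
      using insert.hyps by (simp add: derivS_deriv1 derivS_insert)
  qed
qed

text \<open>Integration by parts reduces orthogonality to the differences of a character, which are again
  characters, and to the fact that nontrivial characters are centred. The latter is integration by
  parts against the constant function \<open>character {}\<close>.\<close>

lemma mean_character_mult_character:
  assumes "finite I" "S \<subseteq> I" "T \<subseteq> I"
  shows "mean I (\<lambda>\<omega>. character S \<omega> * character T \<omega>) = (if S = T then pq ^ card S else 0)"
proof -
  have fin: "finite S" "finite T" using assms finite_subset by blast+
  have mean0: "mean I (character U) = 0" if "U \<subseteq> I" "U \<noteq> {}" for U
  proof -
    have one: "character {} \<omega> = 1" for \<omega> by (simp add: character_def)
    have "finite U" using that(1) assms(1) finite_subset by blast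
    then show ?thesis
      using mean_character_mult[OF assms(1) that(1), of "character {}"] that(2)
        derivS_character[of U "{}"]
      by (simp add: one)
  qed
  have "mean I (\<lambda>\<omega>. character S \<omega> * character T \<omega>)
      = pq ^ card S * mean I (if S \<subseteq> T then character (T - S) else (\<lambda>_. 0))"
    using mean_character_mult[OF assms(1,2), of "character T"] fin by (simp add: derivS_character)
  also have "\<dots> = (if S = T then pq ^ card S else 0)"
    using mean0[of "T - S"] assms(3) by (auto simp: character_def[abs_def])
  finally show ?thesis .
qed

text \<open>The squared norm of the component of \<open>g\<close> along \<open>character T\<close>.\<close>

definition energy :: "'e set \<Rightarrow> 'e set \<Rightarrow> (('e \<Rightarrow> real) \<Rightarrow> real) \<Rightarrow> real" where
  "energy I T g = pq ^ card T * (mean I (DS T g))\<^sup>2"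

lemma energy_nonneg: "0 \<le> energy I T g"
  using pq_pos by (simp add: energy_def)

text \<open>The orthogonal projection of \<open>g\<close> onto the span of the characters indexed by \<open>\<T>\<close>.\<close>

definition truncation ::
    "'e set \<Rightarrow> 'e set set \<Rightarrow> (('e \<Rightarrow> real) \<Rightarrow> real) \<Rightarrow> ('e \<Rightarrow> real) \<Rightarrow> real" where
  "truncation I \<T> g \<omega> = (\<Sum>T\<in>\<T>. mean I (DS T g) * character T \<omega>)"

lemma mean_truncation_mult:
  assumes "finite I" "\<T> \<subseteq> Pow I"
  shows "mean I (\<lambda>\<omega>. truncation I \<T> g \<omega> * g \<omega>) = (\<Sum>T\<in>\<T>. energy I T g)"
proof -
  have "mean I (\<lambda>\<omega>. truncation I \<T> g \<omega> * g \<omega>)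
      = (\<Sum>T\<in>\<T>. mean I (DS T g) * mean I (\<lambda>\<omega>. character T \<omega> * g \<omega>))"
    using assms(1) by (simp add: truncation_def sum_distrib_right mult.assoc)
  also have "\<dots> = (\<Sum>T\<in>\<T>. energy I T g)"
    by (rule sum.cong)
       (use assms in \<open>auto simp: mean_character_mult energy_def power2_eq_square\<close>)
  finally show ?thesis .
qed

lemma mean_truncation_square:
  assumes "finite I" "\<T> \<subseteq> Pow I"
  shows "mean I (\<lambda>\<omega>. (truncation I \<T> g \<omega>)\<^sup>2) = (\<Sum>T\<in>\<T>. energy I T g)"
proof -
  have fin: "finite \<T>" using assms by (auto intro: finite_subset)
  have "mean I (\<lambda>\<omega>. (truncation I \<T> g \<omega>)\<^sup>2)
      = (\<Sum>S\<in>\<T>. \<Sum>T\<in>\<T>. mean I (DS S g) * mean I (DS T g) *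
          mean I (\<lambda>\<omega>. character S \<omega> * character T \<omega>))"
  proof -
    have "(truncation I \<T> g \<omega>)\<^sup>2 = (\<Sum>S\<in>\<T>. \<Sum>T\<in>\<T>. mean I (DS S g) * mean I (DS T g) *
          (character S \<omega> * character T \<omega>))" for \<omega>
      by (simp add: truncation_def power2_eq_square sum_product mult_ac)
    then show ?thesis using assms(1) by simp
  qed
  also have "\<dots> = (\<Sum>S\<in>\<T>. \<Sum>T\<in>\<T>. if S = T then energy I S g else 0)"
  proof (intro sum.cong refl)
    fix S T assume "S \<in> \<T>" "T \<in> \<T>"
    then have "S \<subseteq> I" "T \<subseteq> I" using assms(2) by auto
    from mean_character_mult_character[OF assms(1) this]
    show "mean I (DS S g) * mean I (DS T g) * mean I (\<lambda>\<omega>. character S \<omega> * character T \<omega>)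
        = (if S = T then energy I S g else 0)"
      by (simp add: energy_def power2_eq_square)
  qed
  also have "\<dots> = (\<Sum>T\<in>\<T>. energy I T g)" using fin by simp
  finally show ?thesis .
qed

lemma bessel:
  assumes "finite I" "\<T> \<subseteq> Pow I"
  shows "(\<Sum>T\<in>\<T>. energy I T g) \<le> mean I (\<lambda>\<omega>. (g \<omega>)\<^sup>2)"
proof -
  have "0 \<le> mean I (\<lambda>\<omega>. (g \<omega> - truncation I \<T> g \<omega>)\<^sup>2)" by simp
  also have "(\<lambda>\<omega>. (g \<omega> - truncation I \<T> g \<omega>)\<^sup>2)
      = (\<lambda>\<omega>. (g \<omega>)\<^sup>2 - 2 * (truncation I \<T> g \<omega> * g \<omega>) + (truncation I \<T> g \<omega>)\<^sup>2)"
    by (simp add: power2_eq_square algebra_simps)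
  also have "mean I \<dots> = mean I (\<lambda>\<omega>. (g \<omega>)\<^sup>2) - (\<Sum>T\<in>\<T>. energy I T g)"
    using assms by (simp add: mean_truncation_mult mean_truncation_square)
  finally show ?thesis by simp
qed

text \<open>Let \<open>h\<close> be the truncation of \<open>g\<close> to degree at most \<open>L\<close>, and \<open>H = E h\<^sup>2 = E (h g)\<close>. Hoelder's
  inequality with exponents 4, 4, 2 for \<open>|h|\<close>, \<open>|g|\<^bsup>1/2\<^esup>\<close>, \<open>|g|\<^bsup>1/2\<^esup>\<close>, in the form of two applications
  of Cauchy-Schwarz, gives \<open>H\<^sup>2 \<le> (E h\<^sup>4)\<^bsup>1/2\<^esup> \<parallel>g\<parallel>\<^sub>2 \<parallel>g\<parallel>\<^sub>1\<close>. Bonami's lemma bounds \<open>(E h\<^sup>4)\<^bsup>1/2\<^esup>\<close> by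
  \<open>\<beta>\<^sup>L H\<close>, and one factor \<open>H\<close> cancels.\<close>

lemma low_degree_energy_le:
  assumes "finite I"
  shows "(\<Sum>T | T \<subseteq> I \<and> card T \<le> L. energy I T g)
    \<le> \<beta> ^ L * (sqrt (mean I (\<lambda>\<omega>. (g \<omega>)\<^sup>2)) * mean I (\<lambda>\<omega>. \<bar>g \<omega>\<bar>))"
proof -
  define \<T> where "\<T> = {T. T \<subseteq> I \<and> card T \<le> L}"
  define h where "h = truncation I \<T> g"
  define H where "H = (\<Sum>T\<in>\<T>. energy I T g)"
  define N1 where "N1 = mean I (\<lambda>\<omega>. \<bar>g \<omega>\<bar>)"
  define N2 where "N2 = sqrt (mean I (\<lambda>\<omega>. (g \<omega>)\<^sup>2))"
  have sub: "\<T> \<subseteq> Pow I" by (auto simp: \<T>_def)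
  have H: "mean I (\<lambda>\<omega>. h \<omega> * g \<omega>) = H" "mean I (\<lambda>\<omega>. (h \<omega>)\<^sup>2) = H"
    using assms sub by (simp_all add: h_def H_def mean_truncation_mult mean_truncation_square)
  have nn: "0 \<le> H" "0 \<le> N1" "0 \<le> N2"
    by (simp_all add: H_def N1_def N2_def sum_nonneg energy_nonneg)
  note CS = Cauchy_Schwarz_finite_pmf[OF finite_set_cube_pmf[OF assms]]
  have fourth: "mean I (\<lambda>\<omega>. (h \<omega>) ^ 4) \<le> \<beta> ^ (2 * L) * H\<^sup>2"
    unfolding H(2)[symmetric]
  proof (rule fourth_moment_low_degree[OF assms])
    fix S assume S: "S \<subseteq> I" "L < card S"
    then have finS: "finite S" using assms finite_subset by blast
    have "DS S (character T) = (\<lambda>_. 0)" if "T \<in> \<T>" for T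
    proof -
      have finT: "finite T" using that sub assms finite_subset by blast
      then have "\<not> S \<subseteq> T" using that S card_mono[of T S] by (auto simp: \<T>_def)
      then show ?thesis using finS finT by (simp add: derivS_character)
    qed
    then show "DS S h = (\<lambda>_. 0)"
      using finS by (simp add: h_def truncation_def[abs_def] derivS_sum)
  qed
  have "H\<^sup>2 \<le> (mean I (\<lambda>\<omega>. \<bar>h \<omega>\<bar> * \<bar>g \<omega>\<bar>))\<^sup>2"
  proof -
    have "\<bar>H\<bar> \<le> mean I (\<lambda>\<omega>. \<bar>h \<omega>\<bar> * \<bar>g \<omega>\<bar>)"
      unfolding H(1)[symmetric] using integral_abs_bound[of "cube_pmf I" "\<lambda>\<omega>. h \<omega> * g \<omega>"]
      by (simp add: abs_mult)
    then show ?thesis using abs_le_square_iff by force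
  qed
  also have "\<dots> = (mean I (\<lambda>\<omega>. (\<bar>h \<omega>\<bar> * sqrt \<bar>g \<omega>\<bar>) * sqrt \<bar>g \<omega>\<bar>))\<^sup>2"
    by (simp add: mult.assoc)
  also have "\<dots> \<le> mean I (\<lambda>\<omega>. (h \<omega>)\<^sup>2 * \<bar>g \<omega>\<bar>) * N1"
    using CS[of "\<lambda>\<omega>. \<bar>h \<omega>\<bar> * sqrt \<bar>g \<omega>\<bar>" "\<lambda>\<omega>. sqrt \<bar>g \<omega>\<bar>"]
    by (simp add: power_mult_distrib N1_def)
  also have "mean I (\<lambda>\<omega>. (h \<omega>)\<^sup>2 * \<bar>g \<omega>\<bar>) \<le> \<beta> ^ L * H * N2"
  proof (rule power2_le_imp_le)
    have "(mean I (\<lambda>\<omega>. (h \<omega>)\<^sup>2 * \<bar>g \<omega>\<bar>))\<^sup>2 \<le> mean I (\<lambda>\<omega>. (h \<omega>) ^ 4) * N2\<^sup>2"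
      using CS[of "\<lambda>\<omega>. (h \<omega>)\<^sup>2" "\<lambda>\<omega>. \<bar>g \<omega>\<bar>"] by (simp add: N2_def)
    also have "\<dots> \<le> (\<beta> ^ (2 * L) * H\<^sup>2) * N2\<^sup>2"
      by (rule mult_right_mono[OF fourth]) simp
    finally show "(mean I (\<lambda>\<omega>. (h \<omega>)\<^sup>2 * \<bar>g \<omega>\<bar>))\<^sup>2 \<le> (\<beta> ^ L * H * N2)\<^sup>2"
      by (simp add: power_mult_distrib power_even_eq)
    show "0 \<le> \<beta> ^ L * H * N2" using nn beta_ge by simp
  qed
  finally have sq: "H\<^sup>2 \<le> \<beta> ^ L * H * N2 * N1"
    using nn by (simp add: mult_right_mono)
  have "H \<le> \<beta> ^ L * (N2 * N1)"
  proof (cases "H = 0")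
    case True
    then show ?thesis using nn beta_ge by simp
  next
    case False
    with nn(1) have "0 < H" by simp
    moreover have "H * H \<le> H * (\<beta> ^ L * (N2 * N1))"
      using sq by (simp add: power2_eq_square mult_ac)
    ultimately show ?thesis using mult_le_cancel_left_pos by blast
  qed
  then show ?thesis by (simp add: H_def \<T>_def N1_def N2_def)
qed

section \<open>Trading the degree for a logarithm\<close>

lemma power_div_fact_le_exp:
  fixes y :: real
  assumes "0 \<le> y"
  shows "y ^ k / fact k \<le> exp y"
proof -
  have s: "(\<lambda>n. y ^ n / fact n) sums exp y"
    using exp_converges[of y] by (simp only: real_scaleR_def divide_inverse mult.commute)
  have "(\<Sum>n\<in>{k}. y ^ n / fact n) \<le> (\<Sum>n. y ^ n / fact n)"
    by (rule sum_le_suminf) (use s assms in \<open>auto intro: sums_summable\<close>)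
  then show ?thesis by (simp add: sums_unique[OF s, symmetric])
qed

text \<open>The sum of the constants of the two degree ranges in the next lemma: \<open>1 + 2\<^sup>k k!\<close> compares
  \<open>exp (- X / 2)\<close> with \<open>1 / (1 + X\<^sup>k)\<close>, and \<open>1 + (2 ln \<beta>)\<^sup>k\<close> compares \<open>(1 + X / (2 ln \<beta>))\<^bsup>-k\<^esup>\<close> with it.\<close>

definition damped_const :: "nat \<Rightarrow> real" where
  "damped_const k = 2 + 2 ^ k * fact k + (2 * ln \<beta>) ^ k"

text \<open>The damping factor \<open>(1 + |T|)\<^bsup>-k\<^esup>\<close> controls the energy above a threshold degree, and the
  smallness of the \<open>L\<^sup>1\<close> norm controls the energy below it. The threshold \<open>X / (2 ln \<beta>)\<close> is the point
  where the loss \<open>\<beta>\<^sup>L\<close> uses up half of the gain \<open>\<parallel>g\<parallel>\<^sub>1 / \<parallel>g\<parallel>\<^sub>2 = exp (- X)\<close>.\<close>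

lemma damped_energy_le:
  fixes g :: "('e \<Rightarrow> real) \<Rightarrow> real"
  assumes "finite I" and pos: "0 < mean I (\<lambda>\<omega>. \<bar>g \<omega>\<bar>)"
  shows "(\<Sum>T\<in>Pow I. energy I T g / (1 + real (card T)) ^ k)
    \<le> damped_const k * (mean I (\<lambda>\<omega>. (g \<omega>)\<^sup>2) /
        (1 + (ln (sqrt (mean I (\<lambda>\<omega>. (g \<omega>)\<^sup>2)) / mean I (\<lambda>\<omega>. \<bar>g \<omega>\<bar>))) ^ k))"
proof -
  define N1 where "N1 = mean I (\<lambda>\<omega>. \<bar>g \<omega>\<bar>)"
  define E2 where "E2 = mean I (\<lambda>\<omega>. (g \<omega>)\<^sup>2)"
  define N2 where "N2 = sqrt E2"
  define X where "X = ln (N2 / N1)"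
  define l where "l = 2 * ln \<beta>"
  define L where "L = nat \<lfloor>X / l\<rfloor>"
  have "N1\<^sup>2 \<le> E2"
    using Cauchy_Schwarz_finite_pmf[OF finite_set_cube_pmf[OF assms(1)], of "\<lambda>\<omega>. \<bar>g \<omega>\<bar>" "\<lambda>_. 1"]
    by (simp add: N1_def E2_def)
  then have N12: "N1 \<le> N2" unfolding N2_def by (rule real_le_rsqrt)
  have N1: "0 < N1" using pos by (simp add: N1_def)
  have X0: "0 \<le> X" using N12 N1 by (simp add: X_def)
  have l0: "0 < l" using beta_ge by (simp add: l_def)
  have E2: "N2 * N2 = E2" "0 \<le> E2" by (simp_all add: N2_def E2_def)
  have Lle: "real L \<le> X / l" and Lge: "X / l \<le> real L + 1"
    using X0 l0 unfolding L_def by (simp_all add: of_nat_nat)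
  have low: "(\<Sum>T | T \<subseteq> I \<and> card T \<le> L. energy I T g) \<le> E2 * exp (- (X / 2))"
  proof -
    have "\<beta> ^ L = exp (real L * ln \<beta>)"
      using beta_ge by (simp add: exp_of_nat_mult)
    also have "\<dots> \<le> exp (X / 2)"
      using Lle l0 beta_ge by (simp add: l_def field_simps)
    finally have "\<beta> ^ L * (N2 * N1) \<le> exp (X / 2) * (N2 * N1)"
      using N1 N12 by (intro mult_right_mono) simp_all
    also have "\<dots> = E2 * exp (- (X / 2))"
    proof -
      have "N1 = N2 * exp (- X)"
        using N1 N12 by (simp add: X_def exp_minus field_simps)
      then have "exp (X / 2) * (N2 * N1) = (N2 * N2) * (exp (X / 2) * exp (- X))"
        by (simp only: mult_ac)
      also have "exp (X / 2) * exp (- X) = exp (- (X / 2))" by (simp add: mult_exp_exp)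
      finally show ?thesis by (simp only: E2(1))
    qed
    finally have "\<beta> ^ L * (N2 * N1) \<le> E2 * exp (- (X / 2))" .
    moreover have "(\<Sum>T | T \<subseteq> I \<and> card T \<le> L. energy I T g) \<le> \<beta> ^ L * (N2 * N1)"
      unfolding N1_def N2_def E2_def by (rule low_degree_energy_le[OF assms(1)])
    ultimately show ?thesis by linarith
  qed
  define F where "F T = energy I T g" for T
  have F0: "0 \<le> F T" for T by (simp add: F_def energy_nonneg)
  have "(\<Sum>T\<in>Pow I. F T / (1 + real (card T)) ^ k)
      \<le> (\<Sum>T\<in>Pow I. (if card T \<le> L then F T else 0) + F T / (1 + X / l) ^ k)"
  proof (rule sum_mono)
    fix T
    have "F T / (1 + real (card T)) ^ k \<le> F T / (1 + X / l) ^ k" if "\<not> card T \<le> L"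
    proof -
      have "1 + X / l \<le> 1 + real (card T)" using that Lge by linarith
      then show ?thesis using X0 l0 F0
        by (intro divide_left_mono power_mono mult_pos_pos zero_less_power add_pos_nonneg) auto
    qed
    moreover have "F T / (1 + real (card T)) ^ k \<le> F T"
      using F0[of T] divide_left_mono[of 1 "(1 + real (card T)) ^ k" "F T"]
      by (simp add: one_le_power)
    moreover have "0 \<le> F T / (1 + X / l) ^ k" using F0 X0 l0 by simp
    ultimately show "F T / (1 + real (card T)) ^ k
        \<le> (if card T \<le> L then F T else 0) + F T / (1 + X / l) ^ k"
      using F0[of T] by auto
  qed
  also have "\<dots> = (\<Sum>T | T \<subseteq> I \<and> card T \<le> L. F T) + (\<Sum>T\<in>Pow I. F T) / (1 + X / l) ^ k"
  proof -
    have "(\<Sum>T\<in>Pow I. if card T \<le> L then F T else 0) = (\<Sum>T | T \<subseteq> I \<and> card T \<le> L. F T)"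
      using assms(1) by (simp add: sum.If_cases Int_def)
    then show ?thesis by (simp add: sum.distrib sum_divide_distrib)
  qed
  also have "\<dots> \<le> E2 * exp (- (X / 2)) + E2 / (1 + X / l) ^ k"
    using low bessel[OF assms(1) subset_refl, of g] X0 l0
    by (intro add_mono divide_right_mono) (simp_all add: F_def E2_def)
  also have "\<dots> \<le> E2 * ((1 + 2 ^ k * fact k) / (1 + X ^ k)) + E2 * ((1 + l ^ k) / (1 + X ^ k))"
  proof (intro add_mono)
    have pk: "0 < 1 + X ^ k" using X0 by (simp add: add_pos_nonneg)
    have "(X / 2) ^ k / fact k \<le> exp (X / 2)"
      using X0 by (intro power_div_fact_le_exp) simp
    then have "X ^ k \<le> 2 ^ k * fact k * exp (X / 2)"
      by (simp add: power_divide field_simps)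
    moreover have "1 \<le> exp (X / 2)" using X0 by simp
    ultimately have "1 + X ^ k \<le> (1 + 2 ^ k * fact k) * exp (X / 2)"
      unfolding distrib_right by linarith
    then have "exp (- (X / 2)) \<le> (1 + 2 ^ k * fact k) / (1 + X ^ k)"
      using pk by (simp add: exp_minus field_simps)
    then show "E2 * exp (- (X / 2)) \<le> E2 * ((1 + 2 ^ k * fact k) / (1 + X ^ k))"
      using E2(2) by (rule mult_left_mono)
    have "1 + X ^ k \<le> (1 + l ^ k) * (1 + X / l) ^ k"
    proof -
      have "1 \<le> (1 + X / l) ^ k" using X0 l0 by (intro one_le_power) simp
      moreover have "X ^ k \<le> l ^ k * (1 + X / l) ^ k"
        unfolding power_mult_distrib[symmetric]
        using X0 l0 by (intro power_mono) (simp_all add: field_simps)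
      ultimately show ?thesis by (simp add: algebra_simps)
    qed
    moreover have "0 < (1 + X / l) ^ k" using X0 l0 by (simp add: add_pos_nonneg)
    ultimately have "1 / (1 + X / l) ^ k \<le> (1 + l ^ k) / (1 + X ^ k)"
      using pk by (simp add: divide_simps)
    then show "E2 / (1 + X / l) ^ k \<le> E2 * ((1 + l ^ k) / (1 + X ^ k))"
      using mult_left_mono[of "1 / (1 + X / l) ^ k" "(1 + l ^ k) / (1 + X ^ k)" E2] E2(2) by simp
  qed
  also have "\<dots> = damped_const k * (E2 / (1 + X ^ k))"
    by (simp add: damped_const_def l_def add_divide_distrib algebra_simps)
  finally show ?thesis by (simp add: F_def X_def E2_def N2_def N1_def)
qed

text \<open>The degenerate case of the low-degree bound, with every degree counted as low.\<close>

lemma energy_eq_0: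
  assumes "finite I" and "mean I (\<lambda>\<omega>. \<bar>g \<omega>\<bar>) = 0" and "T \<subseteq> I"
  shows "energy I T g = 0"
proof -
  have "(\<Sum>T | T \<subseteq> I \<and> card T \<le> card I. energy I T g) \<le> 0"
    using low_degree_energy_le[OF assms(1), where L = "card I" and g = g] assms(2) by simp
  moreover have "energy I T g \<le> (\<Sum>T | T \<subseteq> I \<and> card T \<le> card I. energy I T g)"
    using assms(1,3) by (intro member_le_sum energy_nonneg) (auto intro: card_mono)
  ultimately show ?thesis using energy_nonneg[of I T g] by linarith
qed

end

section \<open>Distributing a high-degree sum over the sets of size k\<close>

text \<open>The weight \<open>G S\<close> is divided equally among the subsets \<open>M\<close> of \<open>S\<close> of size \<open>k\<close>; then \<open>S\<close> is
  written as \<open>M \<union> T\<close>.\<close>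

lemma sum_over_large_subsets:
  fixes G :: "'e set \<Rightarrow> real"
  assumes "finite I"
  shows "(\<Sum>S | S \<subseteq> I \<and> k \<le> card S. G S)
    = (\<Sum>M | M \<subseteq> I \<and> card M = k. \<Sum>T\<in>Pow (I - M). G (M \<union> T) / real ((k + card T) choose k))"
proof -
  have inner: "(\<Sum>T\<in>Pow (I - M). G (M \<union> T) / real ((k + card T) choose k))
      = (\<Sum>S | (S \<subseteq> I \<and> k \<le> card S) \<and> M \<subseteq> S. G S / real (card S choose k))"
    if M: "M \<subseteq> I" "card M = k" for M
  proof (rule sum.reindex_bij_witness[where i = "\<lambda>S. S - M" and j = "\<lambda>T. M \<union> T"])
    have finM: "finite M" using M assms finite_subset by blast
    fix T assume T: "T \<in> Pow (I - M)"
    then have finT: "finite T" using assms finite_subset[of T I] by blast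
    have "card (M \<union> T) = k + card T"
      using T M finM finT by (subst card_Un_disjoint) auto
    then show "G (M \<union> T) / real (card (M \<union> T) choose k) = G (M \<union> T) / real ((k + card T) choose k)"
      and "M \<union> T \<in> {S. (S \<subseteq> I \<and> k \<le> card S) \<and> M \<subseteq> S}"
      using T M by auto
  qed (use M in auto)
  have "(\<Sum>S | S \<subseteq> I \<and> k \<le> card S. G S)
      = (\<Sum>S | S \<subseteq> I \<and> k \<le> card S. \<Sum>M | (M \<subseteq> I \<and> card M = k) \<and> M \<subseteq> S. G S / real (card S choose k))"
  proof (rule sum.cong)
    fix S assume "S \<in> {S. S \<subseteq> I \<and> k \<le> card S}"
    then have S: "S \<subseteq> I" "k \<le> card S" by auto
    then have "{M. (M \<subseteq> I \<and> card M = k) \<and> M \<subseteq> S} = {M. M \<subseteq> S \<and> card M = k}" by auto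
    moreover have "card {M. M \<subseteq> S \<and> card M = k} = card S choose k"
      using S assms finite_subset by (intro n_subsets) blast
    moreover have "0 < card S choose k" using S by (simp add: zero_less_binomial)
    ultimately show "G S = (\<Sum>M | (M \<subseteq> I \<and> card M = k) \<and> M \<subseteq> S. G S / real (card S choose k))"
      by simp
  qed simp
  also have "\<dots> = (\<Sum>M | M \<subseteq> I \<and> card M = k.
      \<Sum>S | (S \<subseteq> I \<and> k \<le> card S) \<and> M \<subseteq> S. G S / real (card S choose k))"
    using sum.swap_restrict[of "{S. S \<subseteq> I \<and> k \<le> card S}" "{M. M \<subseteq> I \<and> card M = k}"
        "\<lambda>S M. G S / real (card S choose k)" "\<lambda>S M. M \<subseteq> S"] assms
    by simp
  finally show ?thesis using inner by simp
qed

lemma power_le_binomial: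
  assumes "1 \<le> k"
  shows "(1 + real m) ^ k \<le> real k ^ k * real ((k + m) choose k)"
proof -
  have "(1 + real m) ^ k \<le> real (k + m) ^ k" using assms by (intro power_mono) auto
  also have "\<dots> = real k ^ k * (real (k + m) / real k) ^ k"
    using assms by (simp add: power_divide)
  also have "\<dots> \<le> real k ^ k * real ((k + m) choose k)"
    by (intro mult_left_mono binomial_ge_n_over_k_pow_k) simp_all
  finally show ?thesis .
qed

section \<open>Talagrand's inequality of order k\<close>

lemma Lnorm_1: "Lnorm P 1 g = measure_pmf.expectation P (\<lambda>\<omega>. \<bar>g \<omega>\<bar>)"
  by (simp add: Lnorm_def)

lemma Lnorm_2: "Lnorm P 2 g = sqrt (measure_pmf.expectation P (\<lambda>\<omega>. (g \<omega>)\<^sup>2))"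
  by (simp add: Lnorm_def powr_half_sqrt)

theorem theorem3:
  fixes a b p :: real and k :: nat
  assumes "CARD('d::finite) \<ge> 2" and "0 < a" and "a < b" and "0 < p" and "p < 1" and "k \<ge> 1"
  shows "\<exists>(C :: real) (n\<^sub>0 :: nat). \<forall>n \<ge> n\<^sub>0. \<forall>f :: 'd config \<Rightarrow> real.
    remainder a b p n k f \<le> C *
      (\<Sum>M | M \<subseteq> edges n \<and> card M = k \<and> Lnorm (config_pmf a b p n) 1 (derivS a b M f) \<noteq> 0.
        (Lnorm (config_pmf a b p n) 2 (derivS a b M f))\<^sup>2 /
        (1 + (ln (Lnorm (config_pmf a b p n) 2 (derivS a b M f) /
                  Lnorm (config_pmf a b p n) 1 (derivS a b M f))) ^ k))"
proof -
  interpret biased_cube a b p by unfold_locales (use assms in auto)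
  define C where "C = pq ^ k * real k ^ k * damped_const k"
  have "remainder a b p n k f \<le> C *
      (\<Sum>M | M \<subseteq> edges n \<and> card M = k \<and> Lnorm (config_pmf a b p n) 1 (derivS a b M f) \<noteq> 0.
        (Lnorm (config_pmf a b p n) 2 (derivS a b M f))\<^sup>2 /
        (1 + (ln (Lnorm (config_pmf a b p n) 2 (derivS a b M f) /
                  Lnorm (config_pmf a b p n) 1 (derivS a b M f))) ^ k))"
    for n and f :: "'d config \<Rightarrow> real"
  proof -
    define I where "I = (edges n :: 'd edge set)"
    define P where "P = (config_pmf a b p n :: 'd config pmf)"
    have fin: "finite I" unfolding I_def by (rule finite_edges)
    have P: "P = cube_pmf I" by (simp add: P_def cube_pmf_def config_pmf_def I_def)
    define R where "R M = (Lnorm P 2 (DS M f))\<^sup>2 /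
        (1 + (ln (Lnorm P 2 (DS M f) / Lnorm P 1 (DS M f))) ^ k)" for M
    define \<M> where "\<M> = {M. M \<subseteq> I \<and> card M = k}"
    have fin\<M>: "finite \<M>" using fin by (simp add: \<M>_def)
    have "remainder a b p n k f = (\<Sum>j = k..card I. \<Sum>S | S \<subseteq> I \<and> card S = j. energy I S f)"
      unfolding remainder_eq_sum level_sum_def sum_distrib_left
      by (intro sum.cong) (auto simp: I_def[symmetric] P_def[symmetric] P energy_def)
    also have "\<dots> = (\<Sum>j = k..card I. \<Sum>S | S \<in> {S. S \<subseteq> I \<and> k \<le> card S} \<and> card S = j. energy I S f)"
      by (intro sum.cong) auto
    also have "\<dots> = (\<Sum>S | S \<subseteq> I \<and> k \<le> card S. energy I S f)"
      using fin by (intro sum.group) (auto intro: card_mono)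
    also have "\<dots> = (\<Sum>M\<in>\<M>. \<Sum>T\<in>Pow (I - M). energy I (M \<union> T) f / real ((k + card T) choose k))"
      unfolding \<M>_def by (rule sum_over_large_subsets[OF fin])
    also have "\<dots> \<le> (\<Sum>M\<in>\<M>. pq ^ k * real k ^ k *
        (\<Sum>T\<in>Pow I. energy I T (DS M f) / (1 + real (card T)) ^ k))"
    proof (rule sum_mono)
      fix M assume "M \<in> \<M>"
      then have M: "M \<subseteq> I" "card M = k" "finite M"
        using fin finite_subset by (auto simp: \<M>_def)
      have "(\<Sum>T\<in>Pow (I - M). energy I (M \<union> T) f / real ((k + card T) choose k))
          \<le> (\<Sum>T\<in>Pow (I - M). pq ^ k * real k ^ k * (energy I T (DS M f) / (1 + real (card T)) ^ k))"
      proof (rule sum_mono)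
        fix T assume T: "T \<in> Pow (I - M)"
        then have finT: "finite T" using fin finite_subset[of T I] by blast
        have disj: "M \<inter> T = {}" using T by blast
        have "energy I (M \<union> T) f = pq ^ k * energy I T (DS M f)"
          using derivS_Un[of T M a b f] card_Un_disjoint[OF M(3) finT disj] disj M finT
          by (simp add: energy_def Un_commute Int_commute power_add)
        moreover have "1 / real ((k + card T) choose k) \<le> real k ^ k / (1 + real (card T)) ^ k"
        proof -
          have "0 < (k + card T) choose k" by (simp add: zero_less_binomial)
          then show ?thesis using power_le_binomial[OF assms(6), of "card T"]
            by (simp add: divide_simps add_pos_nonneg)
        qed
        moreover have "0 \<le> pq ^ k * energy I T (DS M f)"
          using pq_pos by (intro mult_nonneg_nonneg energy_nonneg) simp
        ultimately have "energy I (M \<union> T) f * (1 / real ((k + card T) choose k))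
            \<le> pq ^ k * energy I T (DS M f) * (real k ^ k / (1 + real (card T)) ^ k)"
          by (simp only: mult_left_mono)
        then show "energy I (M \<union> T) f / real ((k + card T) choose k)
            \<le> pq ^ k * real k ^ k * (energy I T (DS M f) / (1 + real (card T)) ^ k)"
          by (simp add: mult_ac)
      qed
      \<comment> \<open>The sets \<open>T\<close> that meet \<open>M\<close> are added, which makes the sum range over all energies of \<open>\<partial>\<^sub>M f\<close>.\<close>
      also have "\<dots> \<le> (\<Sum>T\<in>Pow I. pq ^ k * real k ^ k * (energy I T (DS M f) / (1 + real (card T)) ^ k))"
        using fin pq_pos by (intro sum_mono2) (auto simp: energy_nonneg)
      finally show "(\<Sum>T\<in>Pow (I - M). energy I (M \<union> T) f / real ((k + card T) choose k))
          \<le> pq ^ k * real k ^ k * (\<Sum>T\<in>Pow I. energy I T (DS M f) / (1 + real (card T)) ^ k)"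
        by (simp add: sum_distrib_left)
    qed
    also have "\<dots> \<le> (\<Sum>M\<in>\<M>. C * (if Lnorm P 1 (DS M f) \<noteq> 0 then R M else 0))"
    proof (rule sum_mono)
      fix M
      have "(\<Sum>T\<in>Pow I. energy I T (DS M f) / (1 + real (card T)) ^ k)
          \<le> damped_const k * (if Lnorm P 1 (DS M f) \<noteq> 0 then R M else 0)"
        \<comment> \<open>A set \<open>M\<close> with \<open>\<partial>\<^sub>M f = 0\<close> almost surely carries no energy, so leaving it out costs nothing.\<close>
      proof (cases "Lnorm P 1 (DS M f) = 0")
        case True
        then have "mean I (\<lambda>\<omega>. \<bar>DS M f \<omega>\<bar>) = 0" by (simp add: Lnorm_1 P)
        with True show ?thesis by (simp add: energy_eq_0[OF fin])
      next
        case False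
        have "0 \<le> mean I (\<lambda>\<omega>. \<bar>DS M f \<omega>\<bar>)" by simp
        moreover have "mean I (\<lambda>\<omega>. \<bar>DS M f \<omega>\<bar>) \<noteq> 0" using False by (simp add: Lnorm_1 P)
        ultimately have "0 < mean I (\<lambda>\<omega>. \<bar>DS M f \<omega>\<bar>)" by linarith
        from damped_energy_le[OF fin this, of k] False show ?thesis
          by (simp add: R_def Lnorm_1 Lnorm_2 P)
      qed
      then have "pq ^ k * real k ^ k * (\<Sum>T\<in>Pow I. energy I T (DS M f) / (1 + real (card T)) ^ k)
          \<le> pq ^ k * real k ^ k * (damped_const k * (if Lnorm P 1 (DS M f) \<noteq> 0 then R M else 0))"
        using pq_pos by (intro mult_left_mono) auto
      then show "pq ^ k * real k ^ k * (\<Sum>T\<in>Pow I. energy I T (DS M f) / (1 + real (card T)) ^ k)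
          \<le> C * (if Lnorm P 1 (DS M f) \<noteq> 0 then R M else 0)"
        by (simp only: C_def mult.assoc)
    qed
    also have "\<dots> = C * (\<Sum>M | M \<in> \<M> \<and> Lnorm P 1 (DS M f) \<noteq> 0. R M)"
      unfolding sum_distrib_left[symmetric] using fin\<M> by (subst sum.inter_filter) auto
    finally show ?thesis by (simp add: R_def \<M>_def I_def P_def conj_assoc)
  qed
  then show ?thesis by blast
qed

end
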